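(* Assume (B1)–(B3), that $f\in C^2$, that $\int_0^{+\infty}e^{-f(s)/(\beta+1)}ds<\infty$, and that $\lim_{t\to+\infty}g''(t)/g'(t)=0$ where $g=f^{-1}$. Then $I(u(\varepsilon_\rho s,\rho))\to\beta+1$ as $\rho\to+\infty$, uniformly for $s$ in compact subsets of $[0,\infty)$.
   Context: $L(u)(r)=r^{-\gamma}(r^{\alpha}|u'|^{\beta}u')'$, $\theta=\gamma+2+\beta-\alpha$. (B1) $f\in C^1(\mathbb R,\mathbb R)$, $f'>0$, $f\to+\infty$. (B2) $\lim_{u\to+\infty}u^{-1}e^{f(u)/(\beta+1)}=\lim_{u\to+\infty}uf'(u)=+\infty$. (B3) $\alpha>\beta+1>0$, $\theta>0$. $u(\cdot,\rho)$: solution on $[0,\infty)$ of $L(u)+e^{f(u)}=0$, $u(0)=\rho$, $u'(0)=0$. $\mathcal F(u)=\int_u^{\infty}e^{-f(s)/(\beta+1)}ds$, $\mathcal F_1(u)=(\beta+1)e^{-u/(\beta+1)}$, $\varepsilon_\rho=(\mathcal F(\rho)/\mathcal F_1(1))^{(\beta+1)/\theta}$, $I(u)=\mathcal F(u)f'(u)e^{f(u)/(\beta+1)}$. *)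

theory Defs
  imports "HOL-Analysis.Analysis"
begin

text \<open>u is a (radial) solution on [0,inf) of
  r^(-gamma) (r^alpha |u'|^beta u')' + e^(f u) = 0, u(0) = rho, u'(0) = 0.
  The derivative u' exists on [0,inf) (one-sided at 0), and the flux
  r^alpha |u'|^beta u' is differentiable for r > 0 with derivative -r^gamma e^(f(u(r))).\<close>
definition is_sol :: "real \<Rightarrow> real \<Rightarrow> real \<Rightarrow> (real \<Rightarrow> real) \<Rightarrow> (real \<Rightarrow> real) \<Rightarrow> real \<Rightarrow> bool" where
  "is_sol \<alpha> \<beta> \<gamma> f u \<rho> \<longleftrightarrow> u 0 = \<rho> \<and>
     (\<exists>u'. (\<forall>r\<ge>0. (u has_real_derivative u' r) (at r within {0..})) \<and> u' 0 = 0 \<and>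
        (\<forall>r>0. ((\<lambda>t. t powr \<alpha> * \<bar>u' t\<bar> powr \<beta> * u' t) has_real_derivative
                   (- (r powr \<gamma> * exp (f (u r))))) (at r)))"

definition FF :: "real \<Rightarrow> (real \<Rightarrow> real) \<Rightarrow> real \<Rightarrow> real" where
  "FF \<beta> f x = integral {x..} (\<lambda>s. exp (- f s / (\<beta> + 1)))"

definition FF1 :: "real \<Rightarrow> real \<Rightarrow> real" where
  "FF1 \<beta> x = (\<beta> + 1) * exp (- x / (\<beta> + 1))"

definition theta :: "real \<Rightarrow> real \<Rightarrow> real \<Rightarrow> real" where
  "theta \<alpha> \<beta> \<gamma> = \<gamma> + 2 + \<beta> - \<alpha>"

definition eps :: "real \<Rightarrow> real \<Rightarrow> real \<Rightarrow> (real \<Rightarrow> real) \<Rightarrow> real \<Rightarrow> real" where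
  "eps \<alpha> \<beta> \<gamma> f \<rho> = (FF \<beta> f \<rho> / FF1 \<beta> 1) powr ((\<beta> + 1) / theta \<alpha> \<beta> \<gamma>)"

definition II :: "real \<Rightarrow> (real \<Rightarrow> real) \<Rightarrow> real \<Rightarrow> real" where
  "II \<beta> f x = FF \<beta> f x * deriv f x * exp (f x / (\<beta> + 1))"

end

theory Submission
  imports Defs
begin

text \<open>First, I(x) tends to \<beta> + 1 as x \<rightarrow> \<infinity>: by L'Hopital, F(x) behaves
  like e^(-f(x)/(\<beta>+1)) / (f'(x) (1/(\<beta>+1) + f''(x)/f'(x)^2)), and the hypothesis on g = f^(-1)
  says exactly that f''/f'^2 \<rightarrow> 0. Second, the solution stays large on the rescaled interval:
  the flux r^\<alpha> |u'|^\<beta> u' is nonpositive and bounded below by -e^(f(\<rho>)) r^(\<gamma>+1)/(\<gamma>+1),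
  which integrates to \<rho> - u(\<epsilon>(\<rho>) s) \<le> C I(\<rho>) s^(\<theta>/(\<beta>+1)) / f'(\<rho>), and this is o(\<rho>) uniformly
  for bounded s because \<rho> f'(\<rho>) \<rightarrow> \<infinity>.\<close>

lemma lhopital_at_top_0:
  fixes f g f' g' :: "real \<Rightarrow> real"
  assumes f0: "(f \<longlongrightarrow> 0) at_top" and g0: "(g \<longlongrightarrow> 0) at_top"
    and gne: "eventually (\<lambda>x. g x \<noteq> 0) at_top"
    and g': "eventually (\<lambda>x. g' x \<noteq> 0) at_top"
    and Df: "eventually (\<lambda>x. DERIV f x :> f' x) at_top"
    and Dg: "eventually (\<lambda>x. DERIV g x :> g' x) at_top"
    and lim: "((\<lambda>x. f' x / g' x) \<longlongrightarrow> y) at_top"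
  shows "((\<lambda>x. f x / g x) \<longlongrightarrow> y) at_top"
  unfolding filterlim_at_top_to_right
proof (rule lhopital_right_0)
  let ?F = "\<lambda>x. f (inverse x)"
  let ?G = "\<lambda>x. g (inverse x)"
  let ?R = "at_right (0::real)"
  let ?D = "\<lambda>f' x. f' (inverse x) * - (inverse x ^ Suc (Suc 0))"
  show "(?G \<longlongrightarrow> 0) ?R"
    using g0 unfolding filterlim_at_top_to_right .
  show "(?F \<longlongrightarrow> 0) ?R"
    using f0 unfolding filterlim_at_top_to_right .
  show "eventually (\<lambda>x. ?G x \<noteq> 0) ?R"
    unfolding eventually_at_right_to_top using gne by simp
  show "eventually (\<lambda>x. DERIV ?G x :> ?D g' x) ?R"
    unfolding eventually_at_right_to_top
    using Dg eventually_ge_at_top[where c=1]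
    by eventually_elim (rule derivative_eq_intros DERIV_chain'[where f=inverse] | simp)+
  show "eventually (\<lambda>x. DERIV ?F x :> ?D f' x) ?R"
    unfolding eventually_at_right_to_top
    using Df eventually_ge_at_top[where c=1]
    by eventually_elim (rule derivative_eq_intros DERIV_chain'[where f=inverse] | simp)+
  show "eventually (\<lambda>x. ?D g' x \<noteq> 0) ?R"
    unfolding eventually_at_right_to_top
    using g' eventually_ge_at_top[where c=1]
    by eventually_elim auto
  show "((\<lambda>x. ?D f' x / ?D g' x) \<longlongrightarrow> y) ?R"
    unfolding filterlim_at_right_to_top
    apply (intro filterlim_cong[THEN iffD2, OF refl refl _ lim])
    using eventually_ge_at_top[where c=1]
    by eventually_elim simp
qed

lemma uniform_limit_comp_at_top:
  fixes g :: "real \<Rightarrow> real" and w :: "real \<Rightarrow> 'a \<Rightarrow> real"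
  assumes g: "(g \<longlongrightarrow> c) at_top"
    and L: "filterlim L at_top at_top"
    and w_ge: "eventually (\<lambda>\<rho>. \<forall>s\<in>K. L \<rho> \<le> w \<rho> s) at_top"
  shows "uniform_limit K (\<lambda>\<rho> s. g (w \<rho> s)) (\<lambda>s. c) at_top"
  unfolding uniform_limit_iff
proof (intro allI impI)
  fix e :: real assume "e > 0"
  with g have "eventually (\<lambda>x. dist (g x) c < e) at_top" by (rule tendstoD)
  then obtain V where V: "\<And>x. x \<ge> V \<Longrightarrow> dist (g x) c < e"
    by (auto simp: eventually_at_top_linorder)
  have "eventually (\<lambda>\<rho>. L \<rho> \<ge> V) at_top"
    using L by (simp add: filterlim_at_top)
  with w_ge show "eventually (\<lambda>\<rho>. \<forall>s\<in>K. dist (g (w \<rho> s)) c < e) at_top"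
    by eventually_elim (blast intro: V order.trans)
qed


context
  fixes E :: "real \<Rightarrow> real"
  assumes E_cont: "continuous_on UNIV E"
    and E_nonneg: "\<And>x. E x \<ge> 0"
    and E_integrable: "E integrable_on {0..}"
begin

lemma set_integrable_tail:
  assumes "a \<ge> 0"
  shows "set_integrable lebesgue {a..} E"
proof -
  have "set_integrable lebesgue {0..} E"
    by (rule nonnegative_absolutely_integrable_1[OF E_integrable]) (simp add: E_nonneg)
  then show ?thesis
    by (rule set_integrable_subset) (use assms in auto)
qed

lemma integrable_on_tail:
  assumes "a \<ge> 0"
  shows "E integrable_on {a..}"
  using set_lebesgue_integral_eq_integral(1)[OF set_integrable_tail[OF assms]] .

lemma integral_tail_split:
  assumes "0 \<le> a" "a \<le> b"
  shows "integral {a..} E = integral {a..b} E + integral {b..} E"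
proof -
  have "(E has_integral (integral {a..b} E + integral {b..} E)) ({a..b} \<union> {b..})"
  proof (rule has_integral_Un)
    show "(E has_integral integral {a..b} E) {a..b}"
      by (intro integrable_integral integrable_continuous_interval continuous_on_subset[OF E_cont])
        simp
    show "(E has_integral integral {b..} E) {b..}"
      by (intro integrable_integral integrable_on_tail) (use assms in auto)
    show "negligible ({a..b} \<inter> {b..})"
      by (rule negligible_subset[of "{b}"]) auto
  qed
  moreover have "{a..b} \<union> {b..} = {a..}" using assms by auto
  ultimately show ?thesis by (simp add: integral_unique)
qed

lemma tail_integral_tendsto_0: "((\<lambda>x. integral {x..} E) \<longlongrightarrow> 0) at_top"
proof -
  have E_abs: "set_integrable lebesgue {0..} E" by (rule set_integrable_tail) simp
  have "((\<lambda>b. set_lebesgue_integral lebesgue {0..b} E)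
      \<longlongrightarrow> set_lebesgue_integral lebesgue {0..} E) at_top"
    by (rule tendsto_set_lebesgue_integral_at_top[OF _ E_abs]) auto
  moreover have "eventually (\<lambda>b. set_lebesgue_integral lebesgue {0..b} E = integral {0..b} E) at_top"
    by (intro always_eventually allI set_lebesgue_integral_eq_integral(2)
        set_integrable_subset[OF E_abs]) auto
  ultimately have "((\<lambda>b. integral {0..b} E) \<longlongrightarrow> integral {0..} E) at_top"
    by (simp add: set_lebesgue_integral_eq_integral(2)[OF E_abs] tendsto_cong)
  then have "((\<lambda>b. integral {0..} E - integral {0..b} E)
      \<longlongrightarrow> integral {0..} E - integral {0..} E) at_top"
    by (intro tendsto_diff tendsto_const)
  moreover have "eventually (\<lambda>b. integral {0..} E - integral {0..b} E = integral {b..} E) at_top"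
    using eventually_ge_at_top[of "0::real"] by eventually_elim (simp add: integral_tail_split)
  ultimately show ?thesis by (simp add: Lim_transform_eventually)
qed

lemma has_real_derivative_tail_integral:
  assumes x: "x > 0"
  shows "((\<lambda>y. integral {y..} E) has_real_derivative - E x) (at x)"
proof -
  have "((\<lambda>y. integral {y..x+1} E) has_real_derivative - E x) (at x within {0..x+1})"
    by (rule integral_has_real_derivative', rule continuous_on_subset[OF E_cont]) (use x in auto)
  moreover have "at x within {0..x+1} = at x" using x by (intro at_within_Icc_at) auto
  ultimately have "((\<lambda>y. integral {y..x+1} E + integral {x+1..} E) has_real_derivative - E x) (at x)"
    by (auto intro!: derivative_eq_intros)
  then show ?thesis
  proof (rule has_field_derivative_transform_within_open[where S="{0<..<x+1}"])
    fix y assume "y \<in> {0<..<x + 1}"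
    then show "integral {y..x + 1} E + integral {x + 1..} E = integral {y..} E"
      using integral_tail_split[of y "x+1"] by simp
  qed (use x in auto)
qed

end

lemma FF_nonneg: "FF \<beta> f x \<ge> 0"
  unfolding FF_def by (cases "(\<lambda>s. exp (- f s / (\<beta> + 1))) integrable_on {x..}")
    (auto intro: integral_nonneg simp: not_integrable_integral)


context
  fixes f f' f'' :: "real \<Rightarrow> real"
  assumes f_deriv: "\<And>x. (f has_real_derivative f' x) (at x)"
    and f'_deriv: "\<And>x. (f' has_real_derivative f'' x) (at x)"
    and f'_pos: "\<And>x. f' x > 0"
begin

lemma strict_mono_fun: "strict_mono f"
  by (metis DERIV_pos_imp_increasing f_deriv f'_pos strict_monoI)

lemma deriv_fun: "deriv f x = f' x"
  using f_deriv DERIV_imp_deriv by blast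

lemma continuous_on_fun: "continuous_on S f"
  using f_deriv by (meson DERIV_isCont continuous_at_imp_continuous_on)

lemma inv_fun: "inv f (f x) = x"
  by (rule inv_f_f[OF strict_mono_imp_inj_on[OF strict_mono_fun]])

context
  assumes f_top: "filterlim f at_top at_top"
begin

lemma fun_inv_fun:
  assumes "t > f 0"
  shows "f (inv f t) = t"
proof -
  obtain N where N: "\<And>x. x \<ge> N \<Longrightarrow> f x \<ge> t"
    using f_top by (auto simp: filterlim_at_top eventually_at_top_linorder)
  have "f 0 \<le> t" "t \<le> f (max N 0)" using assms N[of "max N 0"] by auto
  then obtain x where "f x = t"
    using IVT[of f 0 t "max N 0"] DERIV_isCont[OF f_deriv] by auto
  then show ?thesis using inv_fun[of x] by simp
qed

lemma DERIV_inv_fun: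
  assumes t: "t > f 0"
  shows "DERIV (inv f) t :> 1 / f' (inv f t)"
proof -
  have "DERIV (inv f) t :> inverse (f' (inv f t))"
  proof (rule DERIV_inverse_function[where f=f and g="inv f" and a="f 0" and b="t + 1"])
    have "isCont (inv f) (f (inv f t))"
      using isCont_inverse_function[where d=1 and x="inv f t" and g="inv f" and f=f]
      by (simp add: inv_fun DERIV_isCont[OF f_deriv])
    then show "isCont (inv f) t" by (simp only: fun_inv_fun[OF t])
  qed (use t f_deriv f'_pos[of "inv f t"] fun_inv_fun in auto)
  then show ?thesis by (simp add: divide_inverse)
qed

lemma deriv_deriv_inv_fun:
  assumes t: "t > f 0"
  shows "deriv (deriv (inv f)) t = - f'' (inv f t) / f' (inv f t) ^ 3"
proof -
  have "eventually (\<lambda>s. s \<in> {f 0<..}) (nhds t)"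
    by (rule eventually_nhds_in_open) (use t in auto)
  then have deriv_inv_eq: "eventually (\<lambda>s. deriv (inv f) s = 1 / f' (inv f s)) (nhds t)"
    by eventually_elim (rule DERIV_imp_deriv[OF DERIV_inv_fun], simp)
  have "DERIV (\<lambda>t. f' (inv f t)) t :> f'' (inv f t) * (1 / f' (inv f t))"
    by (rule DERIV_chain2[OF f'_deriv DERIV_inv_fun[OF t]])
  then have "DERIV (\<lambda>t. 1 / f' (inv f t)) t
      :> - (f'' (inv f t) * (1 / f' (inv f t))) / f' (inv f t) ^ 2"
    using f'_pos[of "inv f t"] by (auto intro!: derivative_eq_intros simp: power2_eq_square)
  then have "DERIV (\<lambda>t. 1 / f' (inv f t)) t :> - f'' (inv f t) / f' (inv f t) ^ 3"
    using f'_pos[of "inv f t"] by (simp add: power2_eq_square power3_eq_cube field_simps)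
  then have "DERIV (deriv (inv f)) t :> - f'' (inv f t) / f' (inv f t) ^ 3"
    by (rule DERIV_cong_ev[OF refl deriv_inv_eq refl, THEN iffD2])
  then show ?thesis by (rule DERIV_imp_deriv)
qed

lemma f''_over_f'_sq_tendsto_0:
  assumes "((\<lambda>t. deriv (deriv (inv f)) t / deriv (inv f) t) \<longlongrightarrow> 0) at_top"
  shows "((\<lambda>x. f'' x / f' x ^ 2) \<longlongrightarrow> 0) at_top"
proof -
  have "((\<lambda>x. deriv (deriv (inv f)) (f x) / deriv (inv f) (f x)) \<longlongrightarrow> 0) at_top"
    using filterlim_compose[OF assms f_top] by (simp add: o_def)
  moreover have "eventually (\<lambda>x. deriv (deriv (inv f)) (f x) / deriv (inv f) (f x)
      = - (f'' x / f' x ^ 2)) at_top"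
    using eventually_gt_at_top[of "0::real"]
  proof eventually_elim
    case (elim x)
    then have fx: "f x > f 0" using strict_mono_fun strict_mono_less by blast
    have dd: "deriv (deriv (inv f)) (f x) = - f'' x / f' x ^ 3"
      using deriv_deriv_inv_fun[OF fx] by (simp add: inv_fun)
    have d: "deriv (inv f) (f x) = 1 / f' x"
      using DERIV_imp_deriv[OF DERIV_inv_fun[OF fx]] by (simp add: inv_fun)
    show ?case
      unfolding dd d using f'_pos[of x] by (simp add: power2_eq_square power3_eq_cube field_simps)
  qed
  ultimately have "((\<lambda>x. - (f'' x / f' x ^ 2)) \<longlongrightarrow> 0) at_top"
    by (rule Lim_transform_eventually)
  from tendsto_minus[OF this] show ?thesis by simp
qed

end


subsection \<open>The limit of I\<close>

lemma DERIV_exp_over_deriv: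
  assumes "c \<noteq> 0"
  shows "DERIV (\<lambda>x. exp (- f x / c) / f' x) x :> - exp (- f x / c) * (1 / c + f'' x / f' x ^ 2)"
proof -
  have "DERIV (\<lambda>x. exp (- f x / c) / f' x) x
      :> (exp (- f x / c) * (- f' x / c) * f' x - exp (- f x / c) * f'' x) / (f' x * f' x)"
    using f'_pos[of x] assms by (auto intro!: derivative_eq_intros f_deriv f'_deriv)
  also have "(exp (- f x / c) * (- f' x / c) * f' x - exp (- f x / c) * f'' x) / (f' x * f' x)
      = - exp (- f x / c) * (1 / c + f'' x / f' x ^ 2)"
    using f'_pos[of x] assms by (simp add: field_simps power2_eq_square)
  finally show ?thesis .
qed

lemma exp_over_deriv_tendsto_0:
  assumes "filterlim (\<lambda>x. exp (f x / c) / x) at_top at_top"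
    and "filterlim (\<lambda>x. x * f' x) at_top at_top"
  shows "((\<lambda>x. exp (- f x / c) / f' x) \<longlongrightarrow> 0) at_top"
proof -
  have "((\<lambda>x. inverse (exp (f x / c) / x) * inverse (x * f' x)) \<longlongrightarrow> 0 * 0) at_top"
    by (intro tendsto_mult tendsto_inverse_0_at_top assms)
  moreover have "eventually (\<lambda>x. inverse (exp (f x / c) / x) * inverse (x * f' x)
      = exp (- f x / c) / f' x) at_top"
    using eventually_gt_at_top[of "0::real"]
    by eventually_elim (use f'_pos in \<open>simp add: field_simps exp_minus\<close>)
  ultimately show ?thesis by (simp add: Lim_transform_eventually)
qed

text \<open>L'Hopital applied to F(x) / (e^(-f(x)/(\<beta>+1)) / f'(x)), a quotient which is exactly I(x).\<close>

lemma II_tendsto: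
  assumes c: "\<beta> + 1 > 0"
    and integrable: "(\<lambda>s. exp (- f s / (\<beta> + 1))) integrable_on {0..}"
    and B2a: "filterlim (\<lambda>x. exp (f x / (\<beta> + 1)) / x) at_top at_top"
    and B2b: "filterlim (\<lambda>x. x * f' x) at_top at_top"
    and h_lim: "((\<lambda>x. f'' x / f' x ^ 2) \<longlongrightarrow> 0) at_top"
  shows "(II \<beta> f \<longlongrightarrow> \<beta> + 1) at_top"
proof -
  define E where "E = (\<lambda>s. exp (- f s / (\<beta> + 1)))"
  have E_cont: "continuous_on UNIV E"
    unfolding E_def using c by (intro continuous_intros continuous_on_fun) auto
  have FF_eq: "FF \<beta> f = (\<lambda>x. integral {x..} E)"
    unfolding FF_def E_def by simp
  have denom_tendsto: "((\<lambda>x. 1 / (\<beta> + 1) + f'' x / f' x ^ 2) \<longlongrightarrow> 1 / (\<beta> + 1)) at_top"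
    using tendsto_add[OF tendsto_const h_lim] by simp
  have "((\<lambda>x. FF \<beta> f x / (E x / f' x)) \<longlongrightarrow> \<beta> + 1) at_top"
  proof (rule lhopital_at_top_0)
    show "(FF \<beta> f \<longlongrightarrow> 0) at_top"
      unfolding FF_eq by (rule tail_integral_tendsto_0[OF E_cont _ integrable[folded E_def]])
        (simp add: E_def)
    show "((\<lambda>x. E x / f' x) \<longlongrightarrow> 0) at_top"
      unfolding E_def by (rule exp_over_deriv_tendsto_0[OF B2a B2b])
    show "eventually (\<lambda>x. E x / f' x \<noteq> 0) at_top"
      using f'_pos by (simp add: E_def less_imp_neq[symmetric])
    show "eventually (\<lambda>x. - E x * (1 / (\<beta> + 1) + f'' x / f' x ^ 2) \<noteq> 0) at_top"
      using tendsto_imp_eventually_ne[OF denom_tendsto] c by (simp add: E_def)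
    show "eventually (\<lambda>x. DERIV (FF \<beta> f) x :> - E x) at_top"
      using eventually_gt_at_top[of "0::real"] unfolding FF_eq
      by eventually_elim
        (rule has_real_derivative_tail_integral[OF E_cont _ integrable[folded E_def]], simp_all add: E_def)
    show "eventually (\<lambda>x. DERIV (\<lambda>x. E x / f' x) x
        :> - E x * (1 / (\<beta> + 1) + f'' x / f' x ^ 2)) at_top"
      unfolding E_def using c by (intro always_eventually allI DERIV_exp_over_deriv) simp
    have "((\<lambda>x. 1 / (1 / (\<beta> + 1) + f'' x / f' x ^ 2)) \<longlongrightarrow> 1 / (1 / (\<beta> + 1))) at_top"
      using c by (intro tendsto_divide tendsto_const denom_tendsto) simp
    then show "((\<lambda>x. - E x / (- E x * (1 / (\<beta> + 1) + f'' x / f' x ^ 2))) \<longlongrightarrow> \<beta> + 1) at_top"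
      by (simp add: E_def)
  qed
  moreover have "FF \<beta> f x / (E x / f' x) = II \<beta> f x" for x
    using f'_pos[of x]
    by (simp add: II_def E_def deriv_fun exp_minus field_simps)
  ultimately show ?thesis by simp
qed

end


subsection \<open>A priori bounds for the radial solution\<close>

lemma abs_flux_le:
  fixes z w \<alpha> \<beta> :: real
  assumes "z > 0" "\<bar>w\<bar> \<le> 1" "\<beta> + 1 > 0"
  shows "\<bar>z powr \<alpha> * \<bar>w\<bar> powr \<beta> * w\<bar> \<le> z powr \<alpha>"
proof (cases "w = 0")
  case False
  then have "\<bar>w\<bar> powr \<beta> * \<bar>w\<bar> = \<bar>w\<bar> powr (\<beta> + 1)"
    by (simp add: powr_add)
  also have "\<dots> \<le> 1" using assms by (intro powr_le1) auto
  finally show ?thesis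
    using mult_left_mono[of "\<bar>w\<bar> powr \<beta> * \<bar>w\<bar>" 1 "z powr \<alpha>"] by (simp add: abs_mult)
qed simp

locale radial_solution =
  fixes \<alpha> \<beta> \<gamma> \<rho> :: real and f v v' :: "real \<Rightarrow> real"
  assumes f_mono: "mono f"
    and B3a: "\<alpha> > \<beta> + 1" and B3b: "\<beta> + 1 > 0" and theta_pos: "theta \<alpha> \<beta> \<gamma> > 0"
    and v_0: "v 0 = \<rho>"
    and v_deriv: "\<And>r. r \<ge> 0 \<Longrightarrow> (v has_real_derivative v' r) (at r within {0..})"
    and v'_0: "v' 0 = 0"
    and flux_deriv: "\<And>r. r > 0 \<Longrightarrow> ((\<lambda>t. t powr \<alpha> * \<bar>v' t\<bar> powr \<beta> * v' t)
                       has_real_derivative - (r powr \<gamma> * exp (f (v r)))) (at r)"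
begin

definition flux :: "real \<Rightarrow> real" where
  "flux t = t powr \<alpha> * \<bar>v' t\<bar> powr \<beta> * v' t"

lemma \<gamma>_pos: "\<gamma> + 1 > 0"
  using B3a theta_pos by (simp add: theta_def)

lemma v_has_derivative:
  assumes "t > 0"
  shows "(v has_real_derivative v' t) (at t)"
proof -
  have "(v has_real_derivative v' t) (at t within {0<..})"
    by (rule has_field_derivative_subset[OF v_deriv]) (use assms in auto)
  moreover have "at t within {0<..} = at t" by (rule at_within_open) (use assms in auto)
  ultimately show ?thesis by simp
qed

lemma continuous_on_v: "continuous_on {0..} v"
  unfolding continuous_on_eq_continuous_within
  by (auto intro: DERIV_continuous[OF v_deriv])

text \<open>u'(0) = 0 is information at the single point 0 (u' need not be continuous there); the
  mean value theorem turns it into points arbitrarily close to 0 where |u'| \<le> 1.\<close>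

lemma small_deriv_near_0:
  assumes "\<delta> > 0"
  shows "\<exists>z. 0 < z \<and> z < \<delta> \<and> \<bar>v' z\<bar> \<le> 1"
proof -
  have "((\<lambda>y. (v y - v 0) / (y - 0)) \<longlongrightarrow> 0) (at 0 within {0..})"
    using v_deriv[of 0] v'_0 by (simp add: has_field_derivative_iff)
  then have "eventually (\<lambda>y. dist ((v y - v 0) / (y - 0)) 0 < 1) (at 0 within {0..})"
    by (rule tendstoD) simp
  then obtain d where d: "d > 0" "\<And>x. x \<in> {0..} \<Longrightarrow> x \<noteq> 0 \<Longrightarrow> dist x 0 < d \<Longrightarrow>
      dist ((v x - v 0) / (x - 0)) 0 < 1"
    unfolding eventually_at by blast
  define \<delta>' where "\<delta>' = min \<delta> (d / 2)"
  have \<delta>': "0 < \<delta>'" "\<delta>' \<le> \<delta>" "\<delta>' < d" using assms d by (auto simp: \<delta>'_def)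
  have "\<exists>l z. 0 < z \<and> z < \<delta>' \<and> DERIV v z :> l \<and> v \<delta>' - v 0 = (\<delta>' - 0) * l"
  proof (rule MVT[OF \<delta>'(1)])
    show "continuous_on {0..\<delta>'} v" by (rule continuous_on_subset[OF continuous_on_v]) auto
    show "v differentiable (at x)" if "0 < x" "x < \<delta>'" for x
      using v_has_derivative[of x] that real_differentiable_def by blast
  qed
  then obtain l z where z: "0 < z" "z < \<delta>'" "DERIV v z :> l" "v \<delta>' - v 0 = \<delta>' * l"
    by auto
  have "l = v' z" using DERIV_unique[OF z(3) v_has_derivative] z by simp
  moreover have "\<bar>l\<bar> < 1"
    using d(2)[of \<delta>'] \<delta>' z(4) by (simp add: abs_mult)
  ultimately show ?thesis using z \<delta>' by auto
qed

lemma flux_small_near_0: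
  assumes "r > 0" "\<eta> > 0"
  shows "\<exists>z. 0 < z \<and> z < r \<and> \<bar>flux z\<bar> \<le> \<eta>"
proof -
  have \<alpha>: "\<alpha> > 0" using B3a B3b by simp
  obtain z where z: "0 < z" "z < min r (\<eta> powr (1 / \<alpha>))" "\<bar>v' z\<bar> \<le> 1"
    using small_deriv_near_0[of "min r (\<eta> powr (1 / \<alpha>))"] assms by auto
  have "\<bar>flux z\<bar> \<le> z powr \<alpha>" unfolding flux_def by (rule abs_flux_le) (use z B3b in auto)
  also have "\<dots> \<le> (\<eta> powr (1 / \<alpha>)) powr \<alpha>" using z \<alpha> by (intro powr_mono2) auto
  also have "\<dots> = \<eta>" using \<alpha> assms by (simp add: powr_powr)
  finally show ?thesis using z by auto
qed

lemma DERIV_flux: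
  assumes "t > 0"
  shows "DERIV flux t :> - (t powr \<gamma> * exp (f (v t)))"
  using flux_deriv[OF assms] unfolding flux_def[abs_def] .

lemma flux_nonpos:
  assumes r: "r > 0"
  shows "flux r \<le> 0"
proof (rule field_le_epsilon)
  fix e :: real assume "e > 0"
  then obtain z where z: "0 < z" "z < r" "\<bar>flux z\<bar> \<le> e"
    using flux_small_near_0[OF r] by blast
  have "flux r \<le> flux z"
  proof (rule DERIV_nonpos_imp_nonincreasing[of z r flux])
    fix x assume "z \<le> x" "x \<le> r"
    then have "x > 0" using z by simp
    then show "\<exists>y. DERIV flux x :> y \<and> y \<le> 0"
      using DERIV_flux[of x] by (intro exI[of _ "- (x powr \<gamma> * exp (f (v x)))"]) auto
  qed (use z in simp)
  then show "flux r \<le> 0 + e" using z by simp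
qed

lemma v'_nonpos:
  assumes "r > 0"
  shows "v' r \<le> 0"
proof (rule ccontr)
  assume "\<not> v' r \<le> 0"
  then have "flux r > 0" using assms by (simp add: flux_def)
  with flux_nonpos[OF assms] show False by simp
qed

lemma v_le_initial:
  assumes "r \<ge> 0"
  shows "v r \<le> \<rho>"
proof -
  have "v r \<le> v 0"
  proof (rule DERIV_nonpos_imp_decreasing_open[OF assms])
    fix x assume "0 < x" "x < r"
    then show "\<exists>y. DERIV v x :> y \<and> y \<le> 0" using v_has_derivative v'_nonpos by blast
  qed (rule continuous_on_subset[OF continuous_on_v], auto)
  then show ?thesis by (simp add: v_0)
qed

text \<open>Since u \<le> \<rho> and f is monotone, the flux decreases at most at rate r^\<gamma> e^(f(\<rho>)).\<close>

lemma flux_lower_bound: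
  assumes r: "r > 0"
  shows "- (exp (f \<rho>) * r powr (\<gamma> + 1) / (\<gamma> + 1)) \<le> flux r"
proof (rule field_le_epsilon)
  fix e :: real assume "e > 0"
  define G where "G t = exp (f \<rho>) * t powr (\<gamma> + 1) / (\<gamma> + 1)" for t
  define \<psi> where "\<psi> t = flux t + G t" for t
  obtain z where z: "0 < z" "z < r" "\<bar>flux z\<bar> \<le> e"
    using flux_small_near_0[OF r \<open>e > 0\<close>] by blast
  have DG: "DERIV G t :> exp (f \<rho>) * t powr \<gamma>" if "t > 0" for t
  proof -
    have "DERIV G t :> exp (f \<rho>) * ((\<gamma> + 1) * t powr (\<gamma> + 1 - 1)) / (\<gamma> + 1)"
      unfolding G_def[abs_def] by (intro DERIV_cdivide DERIV_cmult has_real_derivative_powr that)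
    then show ?thesis using \<gamma>_pos by simp
  qed
  have D\<psi>: "DERIV \<psi> t :> - (t powr \<gamma> * exp (f (v t))) + exp (f \<rho>) * t powr \<gamma>" if "t > 0" for t
    unfolding \<psi>_def[abs_def] by (rule DERIV_add[OF DERIV_flux[OF that] DG[OF that]])
  have "\<psi> z \<le> \<psi> r"
  proof (rule DERIV_nonneg_imp_increasing_open[of z r \<psi>])
    have "\<forall>x\<in>{z..r}. isCont \<psi> x"
      using z DERIV_isCont[OF D\<psi>] by simp
    then show "continuous_on {z..r} \<psi>" by (rule continuous_at_imp_continuous_on)
    fix x assume x: "z < x" "x < r"
    have "exp (f (v x)) \<le> exp (f \<rho>)"
      using f_mono v_le_initial[of x] x z by (simp add: monoD)
    then have "x powr \<gamma> * exp (f (v x)) \<le> x powr \<gamma> * exp (f \<rho>)"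
      by (intro mult_left_mono) auto
    then have "0 \<le> - (x powr \<gamma> * exp (f (v x))) + exp (f \<rho>) * x powr \<gamma>"
      by (simp add: mult.commute)
    then show "\<exists>y. DERIV \<psi> x :> y \<and> 0 \<le> y"
      using D\<psi>[of x] x z by auto
  qed (use z in simp)
  moreover have "G z \<ge> 0" using \<gamma>_pos by (simp add: G_def)
  ultimately have "- G r \<le> flux r + e"
    using z unfolding \<psi>_def by linarith
  then show "- (exp (f \<rho>) * r powr (\<gamma> + 1) / (\<gamma> + 1)) \<le> flux r + e"
    by (simp add: G_def)
qed

lemma v'_lower_bound:
  assumes t: "t > 0"
  shows "- v' t \<le> (exp (f \<rho>) / (\<gamma> + 1)) powr (1 / (\<beta> + 1))
                    * t powr (theta \<alpha> \<beta> \<gamma> / (\<beta> + 1) - 1)"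
proof (cases "v' t = 0")
  case False
  define w where "w = - v' t"
  define K where "K = exp (f \<rho>) / (\<gamma> + 1)"
  have w: "w > 0" using v'_nonpos[OF t] False by (simp add: w_def)
  have K: "K > 0" using \<gamma>_pos by (simp add: K_def)
  have "flux t = - (t powr \<alpha> * w powr (\<beta> + 1))"
    unfolding flux_def w_def using w by (simp add: powr_add w_def)
  then have "t powr \<alpha> * w powr (\<beta> + 1) \<le> K * t powr (\<gamma> + 1)"
    using flux_lower_bound[OF t] by (simp add: K_def)
  then have "w powr (\<beta> + 1) \<le> K * t powr (\<gamma> + 1 - \<alpha>)"
    using t by (simp add: powr_diff field_simps)
  then have "(w powr (\<beta> + 1)) powr (1 / (\<beta> + 1)) \<le> (K * t powr (\<gamma> + 1 - \<alpha>)) powr (1 / (\<beta> + 1))"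
    using B3b w by (intro powr_mono2) auto
  moreover have "(w powr (\<beta> + 1)) powr (1 / (\<beta> + 1)) = w"
    using B3b w by (simp add: powr_powr)
  moreover have "(\<gamma> + 1 - \<alpha>) * (1 / (\<beta> + 1)) = theta \<alpha> \<beta> \<gamma> / (\<beta> + 1) - 1"
    using B3b by (simp add: theta_def field_simps)
  then have "(K * t powr (\<gamma> + 1 - \<alpha>)) powr (1 / (\<beta> + 1))
      = K powr (1 / (\<beta> + 1)) * t powr (theta \<alpha> \<beta> \<gamma> / (\<beta> + 1) - 1)"
    using K t by (simp add: powr_mult powr_powr)
  ultimately show ?thesis by (simp add: w_def K_def)
qed (simp add: \<gamma>_pos)

lemma v_lower_bound:
  assumes r: "r \<ge> 0"
  shows "\<rho> - (exp (f \<rho>) / (\<gamma> + 1)) powr (1 / (\<beta> + 1)) * r powr (theta \<alpha> \<beta> \<gamma> / (\<beta> + 1))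
            / (theta \<alpha> \<beta> \<gamma> / (\<beta> + 1)) \<le> v r"
proof -
  define p where "p = theta \<alpha> \<beta> \<gamma> / (\<beta> + 1)"
  define B where "B = (exp (f \<rho>) / (\<gamma> + 1)) powr (1 / (\<beta> + 1))"
  have p: "p > 0" using theta_pos B3b by (simp add: p_def)
  define W where "W = (\<lambda>t. v t + B * t powr p / p)"
  have "W 0 \<le> W r"
  proof (rule DERIV_nonneg_imp_increasing_open[OF r])
    show "continuous_on {0..r} W"
      unfolding W_def using p
      by (intro continuous_intros continuous_on_subset[OF continuous_on_v] continuous_on_powr') auto
    fix x assume x: "0 < x" "x < r"
    have "DERIV W x :> v' x + B * (p * x powr (p - 1)) / p"
      unfolding W_def using x v_has_derivative[of x] by (auto intro!: derivative_eq_intros)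
    moreover have "v' x + B * (p * x powr (p - 1)) / p \<ge> 0"
      using v'_lower_bound[of x, folded p_def B_def] x p by simp
    ultimately show "\<exists>y. DERIV W x :> y \<and> 0 \<le> y" by blast
  qed
  then show ?thesis using p by (simp add: W_def v_0 B_def p_def)
qed

lemma v_eps_lower_bound:
  assumes s: "s \<ge> 0"
  shows "\<rho> - FF \<beta> f \<rho> * exp (f \<rho> / (\<beta> + 1)) * s powr (theta \<alpha> \<beta> \<gamma> / (\<beta> + 1))
            / ((\<gamma> + 1) powr (1 / (\<beta> + 1)) * FF1 \<beta> 1 * (theta \<alpha> \<beta> \<gamma> / (\<beta> + 1)))
         \<le> v (eps \<alpha> \<beta> \<gamma> f \<rho> * s)"
proof -
  define p where "p = theta \<alpha> \<beta> \<gamma> / (\<beta> + 1)"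
  define r where "r = eps \<alpha> \<beta> \<gamma> f \<rho> * s"
  have p: "p > 0" using theta_pos B3b by (simp add: p_def)
  have FF1: "FF1 \<beta> 1 > 0" using B3b by (simp add: FF1_def)
  have "eps \<alpha> \<beta> \<gamma> f \<rho> powr p = (FF \<beta> f \<rho> / FF1 \<beta> 1) powr 1"
    using B3b theta_pos by (simp add: eps_def powr_powr p_def)
  also have "\<dots> = FF \<beta> f \<rho> / FF1 \<beta> 1" using FF_nonneg FF1 by simp
  finally have r_powr: "r powr p = FF \<beta> f \<rho> / FF1 \<beta> 1 * s powr p"
    using s unfolding r_def by (subst powr_mult) (auto simp: eps_def)
  have B: "(exp (f \<rho>) / (\<gamma> + 1)) powr (1 / (\<beta> + 1))
      = exp (f \<rho> / (\<beta> + 1)) / (\<gamma> + 1) powr (1 / (\<beta> + 1))"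
    by (simp add: powr_divide exp_powr_real)
  have "(exp (f \<rho>) / (\<gamma> + 1)) powr (1 / (\<beta> + 1)) * r powr p / p
      = FF \<beta> f \<rho> * exp (f \<rho> / (\<beta> + 1)) * s powr p
        / ((\<gamma> + 1) powr (1 / (\<beta> + 1)) * FF1 \<beta> 1 * p)"
    unfolding B r_powr using FF1 p \<gamma>_pos by (simp add: field_simps)
  then show ?thesis
    using v_lower_bound[of r, folded p_def] s eps_def by (simp add: r_def p_def)
qed

end

lemma is_sol_imp_radial_solution:
  assumes "is_sol \<alpha> \<beta> \<gamma> f v \<rho>" "mono f"
    and "\<alpha> > \<beta> + 1" "\<beta> + 1 > 0" "theta \<alpha> \<beta> \<gamma> > 0"
  obtains v' where "radial_solution \<alpha> \<beta> \<gamma> \<rho> f v v'"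
  using assms unfolding is_sol_def radial_solution_def by blast


lemma filterlim_minus_o_at_top:
  fixes h f' :: "real \<Rightarrow> real"
  assumes "(h \<longlongrightarrow> c) at_top" "filterlim (\<lambda>x. x * f' x) at_top at_top"
  shows "filterlim (\<lambda>x. x - C * h x / f' x) at_top at_top"
proof -
  have "((\<lambda>x. C * h x * inverse (x * f' x)) \<longlongrightarrow> C * c * 0) at_top"
    by (intro tendsto_intros tendsto_inverse_0_at_top assms)
  then have "eventually (\<lambda>x. C * h x * inverse (x * f' x) < 1 / 2) at_top"
    by (rule order_tendstoD) simp
  moreover have "eventually (\<lambda>x. x * f' x > 0) at_top"
    using assms(2) by (simp add: filterlim_at_top_dense)
  ultimately have "eventually (\<lambda>x. 1 / 2 * x \<le> x - C * h x / f' x) at_top"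
    using eventually_gt_at_top[of 0]
  proof eventually_elim
    case (elim x)
    then have "C * h x / f' x = x * (C * h x * inverse (x * f' x))"
      by (simp add: field_simps)
    also have "\<dots> \<le> x * (1 / 2)" using elim by (intro mult_left_mono) auto
    finally show ?case by simp
  qed
  moreover have "filterlim (\<lambda>x::real. 1 / 2 * x) at_top at_top"
    by (rule filterlim_tendsto_pos_mult_at_top[OF tendsto_const _ filterlim_ident]) simp
  ultimately show ?thesis by (rule filterlim_at_top_mono[rotated])
qed

theorem mainTheorem17:
  fixes \<alpha> \<beta> \<gamma> :: real and f f' f'' :: "real \<Rightarrow> real" and u :: "real \<Rightarrow> real \<Rightarrow> real"
  assumes f_deriv: "\<And>x. (f has_real_derivative f' x) (at x)"
    and f'_deriv: "\<And>x. (f' has_real_derivative f'' x) (at x)"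
    and f''_cont: "continuous_on UNIV f''"
    and f'_pos: "\<And>x. f' x > 0"
    and f_top: "filterlim f at_top at_top"
    and B2a: "filterlim (\<lambda>x. exp (f x / (\<beta> + 1)) / x) at_top at_top"
    and B2b: "filterlim (\<lambda>x. x * f' x) at_top at_top"
    and B3a: "\<alpha> > \<beta> + 1" and B3b: "\<beta> + 1 > 0" and B3c: "theta \<alpha> \<beta> \<gamma> > 0"
    and integr: "(\<lambda>s. exp (- f s / (\<beta> + 1))) integrable_on {0..}"
    and g_lim: "((\<lambda>t. deriv (deriv (inv f)) t / deriv (inv f) t) \<longlongrightarrow> 0) at_top"
    and sol: "\<And>\<rho>. is_sol \<alpha> \<beta> \<gamma> f (\<lambda>r. u r \<rho>) \<rho>"
  shows "\<And>K. compact K \<Longrightarrow> K \<subseteq> {0..} \<Longrightarrow>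
           uniform_limit K (\<lambda>\<rho> s. II \<beta> f (u (eps \<alpha> \<beta> \<gamma> f \<rho> * s) \<rho>)) (\<lambda>s. \<beta> + 1) at_top"
proof -
  fix K :: "real set" assume K: "compact K" "K \<subseteq> {0..}"
  note f_props = f_deriv f'_deriv f'_pos
  have II_lim: "(II \<beta> f \<longlongrightarrow> \<beta> + 1) at_top"
    by (rule II_tendsto[OF f_props B3b integr B2a B2b f''_over_f'_sq_tendsto_0[OF f_props f_top g_lim]])
  obtain S where S: "\<And>s. s \<in> K \<Longrightarrow> s \<le> S"
    using compact_imp_bounded[OF K(1)] bounded_real by (meson abs_le_D1)
  define p where "p = theta \<alpha> \<beta> \<gamma> / (\<beta> + 1)"
  define D where "D = (\<gamma> + 1) powr (1 / (\<beta> + 1)) * FF1 \<beta> 1 * p"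
  have p: "p > 0" using B3b B3c by (simp add: p_def)
  have D: "D > 0" using B3a B3b B3c p by (simp add: D_def FF1_def theta_def)
  define C where "C = S powr p / D"
  show "uniform_limit K (\<lambda>\<rho> s. II \<beta> f (u (eps \<alpha> \<beta> \<gamma> f \<rho> * s) \<rho>)) (\<lambda>s. \<beta> + 1) at_top"
  proof (rule uniform_limit_comp_at_top[OF II_lim filterlim_minus_o_at_top[OF II_lim B2b]])
    show "eventually (\<lambda>\<rho>. \<forall>s\<in>K. \<rho> - C * II \<beta> f \<rho> / f' \<rho> \<le> u (eps \<alpha> \<beta> \<gamma> f \<rho> * s) \<rho>) at_top"
    proof (intro always_eventually allI ballI)
      fix \<rho> s assume "s \<in> K"
      then have s: "0 \<le> s" "s \<le> S" using K(2) S by auto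
      obtain v' where "radial_solution \<alpha> \<beta> \<gamma> \<rho> f (\<lambda>r. u r \<rho>) v'"
        using is_sol_imp_radial_solution[OF sol strict_mono_mono[OF strict_mono_fun[OF f_props]] B3a B3b B3c] .
      then interpret radial_solution \<alpha> \<beta> \<gamma> \<rho> f "\<lambda>r. u r \<rho>" v' .
      define A where "A = FF \<beta> f \<rho> * exp (f \<rho> / (\<beta> + 1))"
      have A: "A \<ge> 0" using FF_nonneg[of \<beta> f \<rho>] by (simp add: A_def)
      have "A * s powr p / D \<le> A * S powr p / D"
        using A D s p by (intro divide_right_mono mult_left_mono powr_mono2) auto
      also have "\<dots> = C * II \<beta> f \<rho> / f' \<rho>"
        using f'_pos[of \<rho>] by (simp add: A_def C_def II_def deriv_fun[OF f_props])
      finally show "\<rho> - C * II \<beta> f \<rho> / f' \<rho> \<le> u (eps \<alpha> \<beta> \<gamma> f \<rho> * s) \<rho>"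
        using v_eps_lower_bound[OF s(1), folded p_def, folded A_def D_def] by linarith
    qed
  qed
qed

end
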